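(* Let $\mathcal X$ be a finite set, and for each $t\ge0$ and $x\in\mathcal X$ let $\hat P\{X=x\mid X^{-t}\}$ be a conditional probability estimate (a function of $X^{-t}$, forming a probability mass function in $x$). Suppose the estimates are weakly consistent: for every stationary process distribution $P$ on $\mathcal X^{\mathbb Z}$ and every $x\in\mathcal X$, $$\hat P\{X=x\mid X^{-t}\}\to P\{X=x\mid X^-\}\quad\text{in }L^1(P)\text{ as }t\to\infty.$$ Define the predictor $\hat X_t=\arg\max_{x\in\mathcal X}\hat P\{X_t=x\mid X^t\}$. Then for any stationary ergodic process $\{X_t\}$ with values in $\mathcal X$ and distribution $P$, the predictor $\hat X_t$ achieves the minimum long run average rate of incorrect guesses in probability, in the sense that $$\frac1n\sum_{0\le t<n}1\{X_t\ne\hat X_t\}\to P\{X\ne\hat X\}\quad\text{in }L^1(P),$$ where $\hat X=\arg\max_{x\in\mathcal X}P\{X=x\mid X^-\}$.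
   Context: Notation: $X=X_0$; $X^t=(X_0,\ldots,X_{t-1})$; $X^{-t}=(X_{-t},\ldots,X_{-1})$ (both empty for $t=0$); $X^-=(\ldots,X_{-2},X_{-1})$. The estimate $\hat P\{X_t=x\mid X^t\}$ is constructed from $X^t$ in the same way as $\hat P\{X=x\mid X^{-t}\}$ is computed from $X^{-t}$, i.e. it is the same function of $t$ symbols applied to $(X_0,\ldots,X_{t-1})$ in place of $(X_{-t},\ldots,X_{-1})$. Ties in the arg max are broken by a fixed rule. $\hat X$ is the best predictor of $X_0$ given the infinite past, and $P\{X\ne\hat X\}=1-E\{\max_{x\in\mathcal X}P\{X=x\mid X^-\}\}$ is the minimum long run average rate of prediction errors. *)

theory Defs
  imports "HOL-Probability.Probability"
begin

abbreviation path_space :: "(int \<Rightarrow> 'a) measure" where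
  "path_space \<equiv> Pi\<^sub>M UNIV (\<lambda>_. count_space UNIV)"

definition shift :: "(int \<Rightarrow> 'a) \<Rightarrow> int \<Rightarrow> 'a" where
  "shift x = (\<lambda>t. x (t + 1))"

definition stationary_distribution :: "(int \<Rightarrow> 'a) measure \<Rightarrow> bool" where
  "stationary_distribution P \<longleftrightarrow>
     prob_space P \<and> sets P = sets path_space \<and> distr P path_space shift = P"

definition ergodic_distribution :: "(int \<Rightarrow> 'a) measure \<Rightarrow> bool" where
  "ergodic_distribution P \<longleftrightarrow>
     (\<forall>A\<in>sets path_space. shift -` A = A \<longrightarrow> measure P A = 0 \<or> measure P A = 1)"

definition random_process :: "'w measure \<Rightarrow> (int \<Rightarrow> 'w \<Rightarrow> 'a) \<Rightarrow> bool" where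
  "random_process M X \<longleftrightarrow> prob_space M \<and> (\<forall>t. X t \<in> M \<rightarrow>\<^sub>M count_space UNIV)"

definition process_distribution :: "'w measure \<Rightarrow> (int \<Rightarrow> 'w \<Rightarrow> 'a) \<Rightarrow> (int \<Rightarrow> 'a) measure" where
  "process_distribution M X = distr M path_space (\<lambda>\<omega> t. X t \<omega>)"

text \<open>The symbols \<open>X\<^sub>s, \<dots>, X\<^bsub>s+t-1\<^esub>\<close> in chronological order, so that
  \<open>X\<^sup>t\<close> is \<open>block X 0 t\<close> and \<open>X\<^bsup>-t\<^esup>\<close> is \<open>block X (- int t) t\<close>.\<close>

definition block :: "(int \<Rightarrow> 'w \<Rightarrow> 'a) \<Rightarrow> int \<Rightarrow> nat \<Rightarrow> 'w \<Rightarrow> 'a list" where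
  "block X s t \<omega> = map (\<lambda>i. X (s + int i) \<omega>) [0..<t]"

text \<open>The \<open>\<sigma>\<close>-algebra generated by the infinite past \<open>(\<dots>, X\<^bsub>-2\<^esub>, X\<^bsub>-1\<^esub>)\<close>.\<close>

definition past_algebra :: "'w measure \<Rightarrow> (int \<Rightarrow> 'w \<Rightarrow> 'a) \<Rightarrow> 'w measure" where
  "past_algebra M X =
     vimage_algebra (space M) (\<lambda>\<omega>. \<lambda>t\<in>{..<0}. X t \<omega>) (Pi\<^sub>M {..<0} (\<lambda>_. count_space UNIV))"

lemma subalgebra_past_algebra:
  assumes "random_process M X"
  shows "subalgebra M (past_algebra M X)"
proof -
  have "(\<lambda>\<omega>. \<lambda>t\<in>{..<0}. X t \<omega>) \<in> M \<rightarrow>\<^sub>M Pi\<^sub>M {..<0} (\<lambda>_. count_space UNIV)"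
    using assms by (intro measurable_restrict) (simp add: random_process_def)
  then show ?thesis
    unfolding subalgebra_def past_algebra_def
    by (auto simp: sets_vimage_algebra measurable_def
        intro!: sets.sigma_sets_subset)
qed

text \<open>A version of \<open>P{X\<^sub>0 = x | X\<^sup>-}\<close>.\<close>

definition past_cond_prob :: "'w measure \<Rightarrow> (int \<Rightarrow> 'w \<Rightarrow> 'a) \<Rightarrow> 'a \<Rightarrow> 'w \<Rightarrow> real" where
  "past_cond_prob M X x = real_cond_exp M (past_algebra M X) (\<lambda>\<omega>. of_bool (X 0 \<omega> = x))"

definition L1_convergent_to :: "'w measure \<Rightarrow> (nat \<Rightarrow> 'w \<Rightarrow> real) \<Rightarrow> ('w \<Rightarrow> real) \<Rightarrow> bool" where
  "L1_convergent_to M f g \<longleftrightarrow>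
     (\<forall>n. integrable M (f n)) \<and> integrable M g \<and>
     (\<lambda>n. \<integral>\<omega>. \<bar>f n \<omega> - g \<omega>\<bar> \<partial>M) \<longlonglongrightarrow> 0"

text \<open>An estimator \<open>Q\<close> maps each list of \<open>t\<close> observed symbols to an estimated mass function for
  the next symbol; consistency concerns the coordinate process on path space.\<close>

definition weakly_consistent :: "('a list \<Rightarrow> 'a pmf) \<Rightarrow> bool" where
  "weakly_consistent Q \<longleftrightarrow>
     (\<forall>P x. stationary_distribution P \<longrightarrow>
        (let X = (\<lambda>t \<omega>. \<omega> t) in
           L1_convergent_to P (\<lambda>t \<omega>. pmf (Q (block X (- int t) t \<omega>)) x) (past_cond_prob P X x)))"

text \<open>A fixed rule for breaking ties selects one element from each nonempty set of maximizers.\<close>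

definition tie_breaking_rule :: "('a set \<Rightarrow> 'a) \<Rightarrow> bool" where
  "tie_breaking_rule tie \<longleftrightarrow> (\<forall>S. S \<noteq> {} \<longrightarrow> tie S \<in> S)"

definition arg_max_by :: "('a set \<Rightarrow> 'a) \<Rightarrow> ('a \<Rightarrow> real) \<Rightarrow> 'a" where
  "arg_max_by tie f = tie {x. is_arg_max f (\<lambda>_. True) x}"

definition online_predictor ::
  "('a set \<Rightarrow> 'a) \<Rightarrow> ('a list \<Rightarrow> 'a pmf) \<Rightarrow> (int \<Rightarrow> 'w \<Rightarrow> 'a) \<Rightarrow> nat \<Rightarrow> 'w \<Rightarrow> 'a" where
  "online_predictor tie Q X t \<omega> = arg_max_by tie (pmf (Q (block X 0 t \<omega>)))"

definition best_predictor ::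
  "('a set \<Rightarrow> 'a) \<Rightarrow> 'w measure \<Rightarrow> (int \<Rightarrow> 'w \<Rightarrow> 'a) \<Rightarrow> 'w \<Rightarrow> 'a" where
  "best_predictor tie M X \<omega> = arg_max_by tie (\<lambda>x. past_cond_prob M X x \<omega>)"

end

theory Submission
  imports Defs
begin

text \<open>
  Write \<open>q\<close> for the conditional distribution of the present symbol given the infinite past, \<open>b\<close> for its
  mode (the best predictor), and \<open>h\<^sub>t\<close> for the mode of the estimate computed from the last \<open>t\<close> symbols.
  Move time \<open>t\<close> to the origin with the shift \<open>T\<close>, so that the online prediction at time \<open>t\<close> is \<open>h\<^sub>t\<close>
  evaluated at \<open>T\<^sup>t \<omega>\<close>. The indicator of an error at time \<open>t\<close> then splits, at the point \<open>T\<^sup>t \<omega>\<close>, into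

  \<^item> the innovation, i.e. the indicator minus its conditional probability \<open>1 - q(h\<^sub>t)\<close> given the past;
  \<^item> the regret \<open>q(b) - q(h\<^sub>t)\<close>;
  \<^item> the smallest possible conditional error probability \<open>1 - q(b)\<close>.

  Innovations at different times are bounded and orthogonal, so their averages tend to 0 in \<open>L\<^sup>2\<close>
  (\<open>innovations_orthogonal\<close>, \<open>innovation_average_tendsto_0\<close>). The regret is at most twice the total
  estimation error (\<open>regret_le_estimation_error\<close>); by stationarity its mean at time \<open>t\<close> is that
  of \<open>q(b) - q(h\<^sub>t)\<close> at the origin, which consistency sends to 0, and so do the averages of these means.
  The last term does not depend on \<open>t\<close>, so the ergodic theorem applies to it, and its mean is the
  error probability of the best predictor.

  The ergodic theorem is derived from a short form of the maximal inequality
  (\<open>integral_nonneg_if_orbit_sums_unbounded\<close>). By ergodicity it forces the orbit sums of a function with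
  negative mean to be bounded above almost everywhere, and convergence of the averages of \<open>f\<close> follows by
  subtracting from \<open>f\<close> and from \<open>- f\<close> constants slightly above their means.

  The decomposition is carried out for an abstract measure-preserving map with a past
  \<open>\<sigma>\<close>-algebra, then specialized to the shift on path space. The given process is handled by
  transferring its conditional probabilities to path space
  (\<open>past_cond_prob_process_distribution\<close>).
\<close>

section \<open>The ergodic theorem\<close>

locale measure_preserving_map = prob_space +
  fixes T :: "'a \<Rightarrow> 'a"
  assumes measurable_T [measurable]: "T \<in> M \<rightarrow>\<^sub>M M"
    and distr_T: "distr M M T = M"
begin

definition orbit_sum :: "('a \<Rightarrow> real) \<Rightarrow> nat \<Rightarrow> 'a \<Rightarrow> real" where
  "orbit_sum g n x = (\<Sum>t<n. g ((T ^^ t) x))"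

lemma orbit_sum_Suc: "orbit_sum g (Suc n) x = g x + orbit_sum g n (T x)"
  by (simp add: orbit_sum_def sum.lessThan_Suc_shift funpow_swap1 del: sum.lessThan_Suc)

lemma orbit_sums_unbounded_T:
  "(\<forall>K. \<exists>n. K < orbit_sum g n (T x)) \<longleftrightarrow> (\<forall>K. \<exists>n. K < orbit_sum g n x)"
proof (intro iffI allI)
  fix K assume "\<forall>K. \<exists>n. K < orbit_sum g n (T x)"
  then obtain n where "K - g x < orbit_sum g n (T x)" by blast
  then have "K < orbit_sum g (Suc n) x" by (simp add: orbit_sum_Suc)
  then show "\<exists>n. K < orbit_sum g n x" ..
next
  fix K assume "\<forall>K. \<exists>n. K < orbit_sum g n x"
  then obtain n where n: "max 0 (K + g x) < orbit_sum g n x" by blast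
  then obtain j where "n = Suc j" by (cases n) (auto simp: orbit_sum_def)
  with n have "K < orbit_sum g j (T x)" by (simp add: orbit_sum_Suc)
  then show "\<exists>n. K < orbit_sum g n (T x)" ..
qed

lemma orbit_sum_diff_const: "orbit_sum (\<lambda>x. f x - c) n x = orbit_sum f n x - real n * c"
  by (simp add: orbit_sum_def sum_subtractf)

lemma orbit_sum_uminus: "orbit_sum (\<lambda>x. - f x) n x = - orbit_sum f n x"
  by (simp add: orbit_sum_def sum_negf)

lemma measurable_funpow_T [measurable]: "(T ^^ t) \<in> M \<rightarrow>\<^sub>M M"
  by (induction t) (simp_all, measurable)

lemma measurable_orbit_sum [measurable]:
  assumes [measurable]: "g \<in> borel_measurable M"
  shows "orbit_sum g n \<in> borel_measurable M"
  unfolding orbit_sum_def by measurable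

lemma integral_T:
  fixes g :: "'a \<Rightarrow> real"
  assumes [measurable]: "g \<in> borel_measurable M"
  shows "(\<integral>x. g (T x) \<partial>M) = (\<integral>x. g x \<partial>M)"
  by (metis assms distr_T integral_distr measurable_T)

lemma integral_funpow_T:
  fixes g :: "'a \<Rightarrow> real"
  assumes [measurable]: "g \<in> borel_measurable M"
  shows "(\<integral>x. g ((T ^^ t) x) \<partial>M) = (\<integral>x. g x \<partial>M)"
proof (induction t)
  case (Suc t)
  have "(\<integral>x. g ((T ^^ Suc t) x) \<partial>M) = (\<integral>x. g ((T ^^ t) (T x)) \<partial>M)"
    by (simp add: funpow_swap1)
  also have "\<dots> = (\<integral>x. g ((T ^^ t) x) \<partial>M)" by (rule integral_T) measurable
  finally show ?case using Suc by simp
qed simp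

lemma integrable_T:
  fixes g :: "'a \<Rightarrow> real"
  assumes "integrable M g"
  shows "integrable M (\<lambda>x. g (T x))"
  using assms by (metis distr_T integrable_distr measurable_T)

text \<open>The maximum of the orbit sums with at most \<open>n\<close> terms, the empty sum included. The recursion
  splits off the first term of the nonempty sums; it is the form that the maximal inequality uses.\<close>

primrec max_orbit_sum :: "('a \<Rightarrow> real) \<Rightarrow> nat \<Rightarrow> 'a \<Rightarrow> real" where
  "max_orbit_sum g 0 x = 0"
| "max_orbit_sum g (Suc n) x = max 0 (g x + max_orbit_sum g n (T x))"

lemma max_orbit_sum_nonneg: "0 \<le> max_orbit_sum g n x"
  by (cases n) auto

lemma max_orbit_sum_mono_Suc: "max_orbit_sum g n x \<le> max_orbit_sum g (Suc n) x"
proof (induction n arbitrary: x)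
  case (Suc n)
  show ?case using Suc[of "T x"] by (auto simp: max_def)
qed simp

lemma orbit_sum_le_max: "k \<le> n \<Longrightarrow> orbit_sum g k x \<le> max_orbit_sum g n x"
proof (induction n arbitrary: k x)
  case (Suc n)
  show ?case
  proof (cases k)
    case 0
    then show ?thesis using max_orbit_sum_nonneg[of g "Suc n" x] by (simp add: orbit_sum_def)
  next
    case (Suc j)
    then show ?thesis using Suc.IH[of j "T x"] Suc.prems by (simp add: orbit_sum_Suc)
  qed
qed (simp add: orbit_sum_def)

lemma integrable_max_orbit_sum:
  assumes "integrable M g"
  shows "integrable M (max_orbit_sum g n)"
proof (induction n)
  case (Suc n)
  from integrable_T[OF this] assms show ?case by simp
qed simp

text \<open>The maximal ergodic inequality, in the form needed below. With \<open>m\<^sub>n\<close> the maximal orbit sum,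
  \<open>m\<^sub>n\<^sub>+\<^sub>1 - m\<^sub>n \<circ> T = max (- m\<^sub>n \<circ> T) g\<close>. The left side has nonnegative integral because \<open>m\<^sub>n\<close> increases in
  \<open>n\<close> and \<open>T\<close> preserves the measure; the right side equals \<open>g\<close> as soon as \<open>m\<^sub>n (T x)\<close> exceeds \<open>- g x\<close>,
  which happens for large \<open>n\<close> when the orbit sums are unbounded above. The absolute
  value of the right side never exceeds that of \<open>g\<close>, so the integrals converge to the integral of \<open>g\<close>.\<close>

lemma integral_nonneg_if_orbit_sums_unbounded:
  assumes g: "integrable M g"
    and unbounded: "AE x in M. \<forall>K. \<exists>n. K < orbit_sum g n x"
  shows "0 \<le> (\<integral>x. g x \<partial>M)"
proof (rule LIMSEQ_le_const)
  let ?m = "max_orbit_sum g"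
  let ?r = "\<lambda>n x. max (- ?m n (T x)) (g x)"
  note [measurable] = borel_measurable_integrable[OF g]
    borel_measurable_integrable[OF integrable_max_orbit_sum[OF g]]
  have lim: "AE x in M. (\<lambda>n. ?r n x) \<longlonglongrightarrow> g x"
    using unbounded
  proof eventually_elim
    case (elim x)
    then have "\<forall>K. \<exists>n. K < orbit_sum g n (T x)" by (rule orbit_sums_unbounded_T[THEN iffD2])
    then obtain N where "- g x < orbit_sum g N (T x)" by blast
    then have "?r n x = g x" if "n \<ge> N" for n
      using orbit_sum_le_max[OF that, of g "T x"] by auto
    then show ?case
      by (intro tendsto_eventually) (auto simp: eventually_sequentially)
  qed
  show "(\<lambda>n. \<integral>x. ?r n x \<partial>M) \<longlonglongrightarrow> (\<integral>x. g x \<partial>M)"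
  proof (rule integral_dominated_convergence)
    show "integrable M (\<lambda>x. \<bar>g x\<bar>)" using g by simp
    show "AE x in M. norm (?r n x) \<le> \<bar>g x\<bar>" for n
    proof (rule AE_I2)
      fix x show "norm (?r n x) \<le> \<bar>g x\<bar>" using max_orbit_sum_nonneg[of g n "T x"] by auto
    qed
  qed (use lim in auto)
  have "0 \<le> (\<integral>x. ?r n x \<partial>M)" for n
  proof -
    have "?r n x = ?m (Suc n) x - ?m n (T x)" for x by (auto simp: max_def)
    then have "(\<integral>x. ?r n x \<partial>M) = (\<integral>x. ?m (Suc n) x \<partial>M) - (\<integral>x. ?m n x \<partial>M)"
      using integrable_max_orbit_sum[OF g] integrable_T[OF integrable_max_orbit_sum[OF g]]
        integral_T[of "?m n"]
      by (simp del: max_orbit_sum.simps)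
    moreover have "(\<integral>x. ?m n x \<partial>M) \<le> (\<integral>x. ?m (Suc n) x \<partial>M)"
      by (intro integral_mono integrable_max_orbit_sum g max_orbit_sum_mono_Suc)
    ultimately show ?thesis by simp
  qed
  then show "\<exists>N. \<forall>n\<ge>N. 0 \<le> (\<integral>x. ?r n x \<partial>M)" by blast
qed

end

locale ergodic_map = measure_preserving_map +
  assumes invariant_trivial:
    "\<And>A. A \<in> sets M \<Longrightarrow> T -` A \<inter> space M = A \<Longrightarrow> prob A = 0 \<or> prob A = 1"
begin

text \<open>The set where the orbit sums of \<open>f - c\<close> are unbounded above is strictly invariant, so it is null or
  of full measure, and the maximal inequality excludes full measure because \<open>f - c\<close> has negative
  integral. Working with this set instead of the upper limit of the averages avoids proving
  that the latter is invariant.\<close>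

lemma orbit_sum_AE_bounded_above:
  assumes f: "integrable M f" and c: "(\<integral>x. f x \<partial>M) < c"
  shows "AE x in M. \<exists>K. \<forall>n. orbit_sum f n x \<le> real n * c + K"
proof -
  define g where "g = (\<lambda>x. f x - c)"
  have g: "integrable M g" using f by (simp add: g_def)
  note [measurable] = borel_measurable_integrable[OF g]
  \<comment> \<open>Bounds range over the naturals so that the set is measurable.\<close>
  define A where "A = {x \<in> space M. \<forall>K::nat. \<exists>n. real K < orbit_sum g n x}"
  have A: "A \<in> sets M" unfolding A_def by measurable
  have unb: "(\<forall>K::nat. \<exists>n. real K < orbit_sum g n y) \<longleftrightarrow> (\<forall>K. \<exists>n. K < orbit_sum g n y)" for y
    by (meson order_le_less_trans real_arch_simple)
  have "T -` A \<inter> space M = A"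
    using measurable_space[OF measurable_T] orbit_sums_unbounded_T[of g] unfolding A_def unb by blast
  then consider "prob A = 0" | "prob A = 1" using invariant_trivial[OF A] by blast
  then show ?thesis
  proof cases
    case 1
    then have "AE x in M. x \<notin> A" using A by (simp add: prob_eq_0)
    with AE_space show ?thesis
    proof eventually_elim
      case (elim x)
      then obtain K :: nat where "\<And>n. orbit_sum g n x \<le> real K"
        by (auto simp: A_def not_less)
      then have "orbit_sum f n x \<le> real n * c + real K" for n
        by (simp add: g_def orbit_sum_diff_const algebra_simps)
      then show ?case by blast
    qed
  next
    case 2
    then have "AE x in M. x \<in> A" using A prob_eq_1 by blast
    then have "AE x in M. \<forall>K. \<exists>n. K < orbit_sum g n x"
      by eventually_elim (simp add: A_def unb)
    then have "0 \<le> (\<integral>x. g x \<partial>M)" by (rule integral_nonneg_if_orbit_sums_unbounded[OF g])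
    also have "\<dots> = (\<integral>x. f x \<partial>M) - c" using f by (simp add: g_def prob_space)
    finally show ?thesis using c by simp
  qed
qed

lemma orbit_average_AE_eventually_less:
  assumes f: "integrable M f" and c: "(\<integral>x. f x \<partial>M) < c"
  shows "AE x in M. eventually (\<lambda>n. orbit_sum f n x / real n < c) sequentially"
proof -
  \<comment> \<open>The gap between \<open>b\<close> and \<open>c\<close> absorbs the bounded error after division by \<open>n\<close>.\<close>
  obtain b where b: "(\<integral>x. f x \<partial>M) < b" "b < c" using dense[OF c] by blast
  show ?thesis using orbit_sum_AE_bounded_above[OF f b(1)]
  proof eventually_elim
    case (elim x)
    then obtain K where K: "\<And>n. orbit_sum f n x \<le> real n * b + K" by blast
    have "(\<lambda>n. b + K / real n) \<longlonglongrightarrow> b + 0"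
      by (intro tendsto_intros lim_const_over_n)
    then have "eventually (\<lambda>n. b + K / real n < c) sequentially"
      using b(2) by (simp add: order_tendsto_iff)
    then show ?case using eventually_gt_at_top[of 0]
    proof eventually_elim
      case (elim n)
      have "orbit_sum f n x / real n \<le> (real n * b + K) / real n"
        using K by (intro divide_right_mono) auto
      also have "\<dots> = b + K / real n" using elim by (simp add: field_simps)
      finally show ?case using elim by simp
    qed
  qed
qed

text \<open>Birkhoff's theorem for an ergodic map: the one-sided estimate for \<open>f\<close> and for \<open>- f\<close>.\<close>

theorem pointwise_ergodic_theorem:
  assumes f: "integrable M f"
  shows "AE x in M. (\<lambda>n. orbit_sum f n x / real n) \<longlonglongrightarrow> (\<integral>x. f x \<partial>M)"
proof -
  let ?I = "\<integral>x. f x \<partial>M"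
  have "AE x in M. \<forall>k. eventually (\<lambda>n. orbit_sum f n x / real n < ?I + 1 / real (Suc k)) sequentially"
    unfolding AE_all_countable by (intro allI orbit_average_AE_eventually_less f) simp
  moreover have "AE x in M. \<forall>k. eventually (\<lambda>n. orbit_sum (\<lambda>x. - f x) n x / real n
      < - ?I + 1 / real (Suc k)) sequentially"
    unfolding AE_all_countable
    by (intro allI orbit_average_AE_eventually_less) (use f in auto)
  ultimately show ?thesis
  proof eventually_elim
    case (elim x)
    show ?case
    proof (rule tendstoI)
      fix e :: real assume "0 < e"
      then obtain k where k: "1 / real (Suc k) < e"
        using nat_approx_posE by blast
      from elim(1)[rule_format, of k] elim(2)[rule_format, of k]
      show "eventually (\<lambda>n. dist (orbit_sum f n x / real n) ?I < e) sequentially"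
        by eventually_elim (use k in \<open>auto simp: dist_real_def orbit_sum_uminus abs_less_iff\<close>)
    qed
  qed
qed

theorem mean_ergodic_theorem_bounded:
  assumes [measurable]: "f \<in> borel_measurable M"
    and bound: "\<And>x. x \<in> space M \<Longrightarrow> \<bar>f x\<bar> \<le> B"
  shows "(\<lambda>n. \<integral>x. \<bar>orbit_sum f n x / real n - (\<integral>x. f x \<partial>M)\<bar> \<partial>M) \<longlonglongrightarrow> 0"
proof -
  let ?I = "\<integral>x. f x \<partial>M"
  have f: "integrable M f"
    using bound by (intro integrable_const_bound[where B=B]) auto
  have avg: "\<bar>orbit_sum f n x / real n\<bar> \<le> B" if x: "x \<in> space M" for n x
  proof -
    have B: "0 \<le> B" using bound[OF x] by linarith
    have "\<bar>orbit_sum f n x\<bar> \<le> (\<Sum>t<n. \<bar>f ((T ^^ t) x)\<bar>)"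
      unfolding orbit_sum_def by (rule sum_abs)
    also have "\<dots> \<le> (\<Sum>t<n. B)"
      by (intro sum_mono bound measurable_space[OF measurable_funpow_T] x)
    finally show ?thesis using B by (cases "n = 0") (auto simp: field_simps)
  qed
  have "(\<lambda>n. \<integral>x. \<bar>orbit_sum f n x / real n - ?I\<bar> \<partial>M) \<longlonglongrightarrow> (\<integral>x. 0 \<partial>M)"
  proof (rule integral_dominated_convergence)
    show "integrable M (\<lambda>x. B + \<bar>?I\<bar>)" by simp
    show "AE x in M. norm \<bar>orbit_sum f n x / real n - ?I\<bar> \<le> B + \<bar>?I\<bar>" for n
    proof (rule AE_I2)
      fix x assume "x \<in> space M"
      then show "norm \<bar>orbit_sum f n x / real n - ?I\<bar> \<le> B + \<bar>?I\<bar>"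
        using avg[of x n] abs_triangle_ineq4[of "orbit_sum f n x / real n" ?I]
        unfolding real_norm_def abs_idempotent by linarith
    qed
    show "AE x in M. (\<lambda>n. \<bar>orbit_sum f n x / real n - ?I\<bar>) \<longlonglongrightarrow> 0"
      using pointwise_ergodic_theorem[OF f]
      by eventually_elim (auto intro: tendsto_rabs_zero simp: LIM_zero_iff)
  qed auto
  then show ?thesis by simp
qed

end

section \<open>Averages and absolute moments\<close>

lemma cesaro_mean_tendsto_zero:
  fixes a :: "nat \<Rightarrow> real"
  assumes "a \<longlonglongrightarrow> 0"
  shows "(\<lambda>n. (\<Sum>t<n. a t) / real n) \<longlonglongrightarrow> 0"
proof (rule LIMSEQ_I)
  fix e :: real assume e: "0 < e"
  then obtain N where N: "\<And>t. t \<ge> N \<Longrightarrow> \<bar>a t\<bar> < e / 2"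
    using LIMSEQ_D[OF assms, of "e / 2"] by auto
  define C where "C = (\<Sum>t<N. \<bar>a t\<bar>)"
  have "eventually (\<lambda>n. C / real n < e / 2) sequentially"
    using e by (intro order_tendstoD(2)[OF lim_const_over_n]) simp
  then obtain N' where N': "\<And>n. n \<ge> N' \<Longrightarrow> C / real n < e / 2"
    by (auto simp: eventually_sequentially)
  have "norm ((\<Sum>t<n. a t) / real n - 0) < e" if n: "n \<ge> max (Suc N) N'" for n
  proof -
    have "\<bar>\<Sum>t<n. a t\<bar> \<le> (\<Sum>t<n. \<bar>a t\<bar>)" by (rule sum_abs)
    also have "\<dots> = C + (\<Sum>t\<in>{N..<n}. \<bar>a t\<bar>)"
      using n by (simp add: C_def lessThan_atLeast0 sum.atLeastLessThan_concat)
    also have "(\<Sum>t\<in>{N..<n}. \<bar>a t\<bar>) \<le> (\<Sum>t\<in>{N..<n}. e / 2)"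
      by (intro sum_mono) (use N in \<open>auto intro: less_imp_le\<close>)
    also have "\<dots> \<le> real n * (e / 2)" using e by simp
    finally have "\<bar>\<Sum>t<n. a t\<bar> / real n \<le> C / real n + e / 2"
      using n by (simp add: field_simps)
    also have "C / real n < e / 2" using N' n by simp
    also have "e / 2 + e / 2 = e" by simp
    finally show ?thesis by simp
  qed
  then show "\<exists>no. \<forall>n\<ge>no. norm ((\<Sum>t<n. a t) / real n - 0) < e" by blast
qed

lemma (in prob_space) integral_abs_le_sqrt:
  fixes f :: "'a \<Rightarrow> real"
  assumes f: "integrable M f" and f2: "integrable M (\<lambda>x. (f x)\<^sup>2)"
  shows "(\<integral>x. \<bar>f x\<bar> \<partial>M) \<le> sqrt (\<integral>x. (f x)\<^sup>2 \<partial>M)"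
proof (rule real_le_rsqrt)
  have "0 \<le> variance (\<lambda>x. \<bar>f x\<bar>)" by (rule variance_positive)
  also have "\<dots> = (\<integral>x. (f x)\<^sup>2 \<partial>M) - (\<integral>x. \<bar>f x\<bar> \<partial>M)\<^sup>2"
    by (subst variance_eq) (use f f2 in auto)
  finally show "(\<integral>x. \<bar>f x\<bar> \<partial>M)\<^sup>2 \<le> (\<integral>x. (f x)\<^sup>2 \<partial>M)" by simp
qed

section \<open>Prediction from the past of a measure-preserving map\<close>

text \<open>One step of prediction seen from the present: \<open>Y\<close> is the symbol to be predicted, \<open>F\<close> the
  \<open>\<sigma>\<close>-algebra of the past, \<open>q\<close> a version of the conditional distribution of \<open>Y\<close> given \<open>F\<close> chosen within
  \<open>[0, 1]\<close> everywhere, and \<open>T\<close> moves one step into the future. The inverse \<open>U\<close> of \<open>T\<close> expresses that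
  time only adds information: earlier pasts and the earlier symbols are determined by the past.\<close>

locale stationary_prediction = measure_preserving_map +
  fixes U :: "'a \<Rightarrow> 'a" and F :: "'a measure"
    and Y :: "'a \<Rightarrow> 'b::finite" and q :: "'b \<Rightarrow> 'a \<Rightarrow> real"
  assumes U_T: "\<And>x. x \<in> space M \<Longrightarrow> U (T x) = x"
    and subalg: "subalgebra M F"
    and U_past [measurable]: "U \<in> F \<rightarrow>\<^sub>M F"
    and Y [measurable]: "Y \<in> M \<rightarrow>\<^sub>M count_space UNIV"
    and Y_U [measurable]: "(\<lambda>x. Y (U x)) \<in> F \<rightarrow>\<^sub>M count_space UNIV"
    and q_past [measurable]: "\<And>y. q y \<in> borel_measurable F"
    and q_nonneg: "\<And>y x. 0 \<le> q y x"
    and q_le_1: "\<And>y x. q y x \<le> 1"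
    and q_cond_prob: "\<And>y. AE x in M. q y x = real_cond_exp M F (\<lambda>x. of_bool (Y x = y)) x"
begin

lemma past_measurable: "f \<in> F \<rightarrow>\<^sub>M N \<Longrightarrow> f \<in> M \<rightarrow>\<^sub>M N"
  by (rule measurable_from_subalg[OF subalg])

lemma q_measurable [measurable]: "q y \<in> borel_measurable M"
  by (rule past_measurable) measurable

lemma integral_cond_prob:
  assumes g [measurable]: "g \<in> borel_measurable F" and B: "\<And>x. \<bar>g x\<bar> \<le> B"
  shows "(\<integral>x. g x * q y x \<partial>M) = (\<integral>x. g x * of_bool (Y x = y) \<partial>M)"
proof -
  interpret finite_measure_subalgebra M F by unfold_locales (rule subalg)
  have [measurable]: "g \<in> borel_measurable M" by (rule past_measurable) measurable
  have int: "integrable M (\<lambda>x. g x * of_bool (Y x = y))"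
    using B by (intro integrable_const_bound[where B=B] AE_I2)
      (auto simp: of_bool_def intro: order_trans[OF abs_ge_zero B])
  have "(\<integral>x. g x * q y x \<partial>M) = (\<integral>x. g x * real_cond_exp M F (\<lambda>x. of_bool (Y x = y)) x \<partial>M)"
    using q_cond_prob[of y] by (intro integral_cong_AE) auto
  also have "\<dots> = (\<integral>x. g x * of_bool (Y x = y) \<partial>M)"
    by (rule real_cond_exp_intg(2)[OF int]) measurable
  finally show ?thesis .
qed

text \<open>The prediction error of the guess \<open>h\<close> minus its conditional expectation given the past, provided
  that \<open>h\<close> is determined by the past.\<close>

definition innovation :: "('a \<Rightarrow> 'b) \<Rightarrow> 'a \<Rightarrow> real" where
  "innovation h x = of_bool (Y x \<noteq> h x) - (1 - q (h x) x)"

lemma innovation_eq_sum: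
  "innovation h x = (\<Sum>y\<in>UNIV. of_bool (h x = y) * (q y x - of_bool (Y x = y)))"
proof -
  have "(\<Sum>y\<in>UNIV. of_bool (h x = y) * (q y x - of_bool (Y x = y))) =
      (\<Sum>y\<in>UNIV. if h x = y then q y x - of_bool (Y x = y) else 0)"
    by (intro sum.cong) auto
  then show ?thesis by (simp add: innovation_def)
qed

lemma abs_innovation_le_1: "\<bar>innovation h x\<bar> \<le> 1"
  using q_nonneg[of "h x" x] q_le_1[of "h x" x] by (simp add: innovation_def)

lemma q_at_past [measurable]:
  assumes [measurable]: "h \<in> F \<rightarrow>\<^sub>M count_space UNIV"
  shows "(\<lambda>x. q (h x) x) \<in> borel_measurable F"
  by (rule measurable_compose_countable[where f=q]) measurable

lemma innovation_measurable:
  assumes h [measurable]: "h \<in> F \<rightarrow>\<^sub>M count_space UNIV"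
  shows "innovation h \<in> borel_measurable M"
proof -
  note past_measurable[OF h, measurable] past_measurable[OF q_at_past[OF h], measurable]
  show ?thesis unfolding innovation_def by measurable
qed

text \<open>Since \<open>h\<close> depends on the past only, on each event \<open>h = y\<close> the random symbol \<open>h\<close> can be treated as
  the constant \<open>y\<close>, for which the claim is the definition of conditional probability.\<close>

lemma integral_past_times_innovation:
  assumes g [measurable]: "g \<in> borel_measurable F" and B: "\<And>x. \<bar>g x\<bar> \<le> B"
    and h [measurable]: "h \<in> F \<rightarrow>\<^sub>M count_space UNIV"
  shows "(\<integral>x. g x * innovation h x \<partial>M) = 0"
proof -
  note past_measurable[OF g, measurable] past_measurable[OF h, measurable]
  have B0: "0 \<le> B" using B[of undefined] by linarith
  define u where "u y x = g x * of_bool (h x = y)" for y x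
  have u [measurable]: "u y \<in> borel_measurable F" for y unfolding u_def by measurable
  note past_measurable[OF u, measurable]
  have u_B: "\<bar>u y x\<bar> \<le> B" for y x using B B0 by (simp add: u_def of_bool_def)
  have int: "integrable M (\<lambda>x. u y x * v x)"
    if [measurable]: "v \<in> borel_measurable M" and v: "\<And>x. 0 \<le> v x" "\<And>x. v x \<le> 1" for v y
  proof (rule integrable_const_bound[where B=B])
    have "\<bar>u y x\<bar> * \<bar>v x\<bar> \<le> B * 1" for x
      using u_B[of y x] v[of x] B0 by (intro mult_mono) auto
    then show "AE x in M. norm (u y x * v x) \<le> B" by (simp add: abs_mult)
  qed measurable
  have "g x * innovation h x = (\<Sum>y\<in>UNIV. u y x * q y x - u y x * of_bool (Y x = y))" for x
    unfolding innovation_eq_sum sum_distrib_left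
    by (intro sum.cong refl) (simp add: u_def algebra_simps)
  then have "(\<integral>x. g x * innovation h x \<partial>M) =
      (\<Sum>y\<in>UNIV. (\<integral>x. u y x * q y x \<partial>M) - (\<integral>x. u y x * of_bool (Y x = y) \<partial>M))"
    by (simp add: int q_nonneg q_le_1)
  also have "\<dots> = 0" using integral_cond_prob[OF u u_B] by simp
  finally show ?thesis .
qed

lemma U_funpow_T: "x \<in> space M \<Longrightarrow> (U ^^ k) ((T ^^ k) x) = x"
proof (induction k)
  case (Suc k)
  have "(U ^^ Suc k) ((T ^^ Suc k) x) = (U ^^ k) (U (T ((T ^^ k) x)))"
    by (simp add: funpow_swap1)
  also have "U (T ((T ^^ k) x)) = (T ^^ k) x"
    using Suc.prems measurable_space[OF measurable_funpow_T] by (intro U_T) auto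
  finally show ?case using Suc by simp
qed simp

lemma innovation_backward_past:
  assumes [measurable]: "h \<in> F \<rightarrow>\<^sub>M count_space UNIV"
  shows "(\<lambda>x. innovation h ((U ^^ Suc k) x)) \<in> borel_measurable F"
proof -
  have [measurable]: "U ^^ k \<in> F \<rightarrow>\<^sub>M F" for k by (induction k) (simp_all, measurable)
  have "(\<lambda>x. Y (U ((U ^^ k) x))) \<in> F \<rightarrow>\<^sub>M count_space UNIV"
    by (rule measurable_compose[OF _ Y_U]) measurable
  then have [measurable]: "(\<lambda>x. Y ((U ^^ Suc k) x)) \<in> F \<rightarrow>\<^sub>M count_space UNIV" by simp
  have [measurable]: "(\<lambda>x. q (h ((U ^^ Suc k) x)) ((U ^^ Suc k) x)) \<in> borel_measurable F"
    by (rule measurable_compose[OF _ q_at_past]) measurable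
  show ?thesis unfolding innovation_def by measurable
qed

text \<open>Seen from time \<open>t\<close>, the innovation of the earlier time \<open>s\<close> is part of the past, and the
  innovation at time \<open>t\<close> is orthogonal to the past.\<close>

lemma innovations_orthogonal:
  assumes h: "h \<in> F \<rightarrow>\<^sub>M count_space UNIV" and h': "h' \<in> F \<rightarrow>\<^sub>M count_space UNIV"
    and "s < t"
  shows "(\<integral>x. innovation h ((T ^^ s) x) * innovation h' ((T ^^ t) x) \<partial>M) = 0"
proof -
  note innovation_measurable[OF h, measurable] innovation_measurable[OF h', measurable]
  obtain k where t: "t = Suc k + s" using \<open>s < t\<close> less_imp_Suc_add[of s t] by (auto simp: add.commute)
  have past: "(\<lambda>x. innovation h ((U ^^ Suc k) x)) \<in> borel_measurable F"
    using h by (rule innovation_backward_past)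
  note past_measurable[OF this, measurable]
  have "(\<integral>x. innovation h ((T ^^ s) x) * innovation h' ((T ^^ t) x) \<partial>M) =
      (\<integral>x. innovation h x * innovation h' ((T ^^ Suc k) x) \<partial>M)"
    by (subst integral_funpow_T[symmetric, where t=s], measurable) (simp add: t funpow_add)
  also have "\<dots> = (\<integral>x. innovation h ((U ^^ Suc k) ((T ^^ Suc k) x)) *
      innovation h' ((T ^^ Suc k) x) \<partial>M)"
    by (intro Bochner_Integration.integral_cong) (simp_all add: U_funpow_T del: funpow.simps)
  also have "\<dots> = (\<integral>x. innovation h ((U ^^ Suc k) x) * innovation h' x \<partial>M)"
    by (rule integral_funpow_T[where t="Suc k"]) measurable
  also have "\<dots> = 0"
    by (rule integral_past_times_innovation[OF past abs_innovation_le_1 h'])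
  finally show ?thesis .
qed

lemma integral_square_sum_innovations:
  assumes h: "\<And>t. h t \<in> F \<rightarrow>\<^sub>M count_space UNIV"
  shows "(\<integral>x. (\<Sum>t<n. innovation (h t) ((T ^^ t) x))\<^sup>2 \<partial>M) \<le> real n"
proof -
  note innovation_measurable[OF h, measurable]
  let ?d = "\<lambda>t x. innovation (h t) ((T ^^ t) x)"
  have prod_le: "\<bar>?d s x * ?d t x\<bar> \<le> 1" for s t x
    using mult_mono[of "\<bar>?d s x\<bar>" 1 "\<bar>?d t x\<bar>" 1] abs_innovation_le_1 by (simp add: abs_mult)
  have int: "integrable M (\<lambda>x. ?d s x * ?d t x)" for s t
    by (rule integrable_const_bound[where B=1]) (use prod_le in auto)
  have ort: "(\<integral>x. ?d s x * ?d t x \<partial>M) = 0" if "s \<noteq> t" for s t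
  proof (cases "s < t")
    case True
    then show ?thesis by (rule innovations_orthogonal[OF h h])
  next
    case False
    then have "(\<integral>x. ?d t x * ?d s x \<partial>M) = 0"
      using that by (intro innovations_orthogonal h) auto
    then show ?thesis by (simp add: mult.commute)
  qed
  have diag: "(\<integral>x. ?d t x * ?d t x \<partial>M) \<le> 1" for t
  proof -
    have "(\<integral>x. ?d t x * ?d t x \<partial>M) \<le> (\<integral>x. 1 \<partial>M)"
      by (intro integral_mono int integrable_const abs_le_D1[OF prod_le])
    then show ?thesis by (simp add: prob_space)
  qed
  have "(\<integral>x. (\<Sum>t<n. ?d t x)\<^sup>2 \<partial>M) = (\<Sum>s<n. \<Sum>t<n. \<integral>x. ?d s x * ?d t x \<partial>M)"
    by (simp add: power2_eq_square sum_product int)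
  also have "\<dots> = (\<Sum>s<n. \<integral>x. ?d s x * ?d s x \<partial>M)"
  proof (intro sum.cong refl)
    fix s assume "s \<in> {..<n}"
    have "(\<Sum>t<n. \<integral>x. ?d s x * ?d t x \<partial>M) = (\<Sum>t\<in>{s}. \<integral>x. ?d s x * ?d t x \<partial>M)"
      using \<open>s \<in> {..<n}\<close> ort by (intro sum.mono_neutral_right) auto
    then show "(\<Sum>t<n. \<integral>x. ?d s x * ?d t x \<partial>M) = (\<integral>x. ?d s x * ?d s x \<partial>M)" by simp
  qed
  also have "\<dots> \<le> (\<Sum>s<n. 1)" using diag by (intro sum_mono)
  finally show ?thesis by simp
qed

text \<open>The weak law for bounded martingale differences: the sum of \<open>n\<close> orthogonal terms has norm at most
  \<open>sqrt n\<close> in \<open>L\<^sup>2\<close>, hence in \<open>L\<^sup>1\<close>.\<close>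

lemma innovation_average_tendsto_0:
  assumes h: "\<And>t. h t \<in> F \<rightarrow>\<^sub>M count_space UNIV"
  shows "(\<lambda>n. \<integral>x. \<bar>(\<Sum>t<n. innovation (h t) ((T ^^ t) x)) / real n\<bar> \<partial>M) \<longlonglongrightarrow> 0"
proof (rule Lim_null_comparison)
  note innovation_measurable[OF h, measurable]
  let ?S = "\<lambda>n x. \<Sum>t<n. innovation (h t) ((T ^^ t) x)"
  have S_le: "\<bar>?S n x\<bar> \<le> real n" for n x
  proof -
    have "\<bar>?S n x\<bar> \<le> (\<Sum>t<n. \<bar>innovation (h t) ((T ^^ t) x)\<bar>)" by (rule sum_abs)
    also have "\<dots> \<le> (\<Sum>t<n. 1)" by (intro sum_mono abs_innovation_le_1)
    finally show ?thesis by simp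
  qed
  have int: "integrable M (?S n)" for n
    by (rule integrable_const_bound[where B="real n"]) (use S_le in auto)
  have int2: "integrable M (\<lambda>x. (?S n x)\<^sup>2)" for n
  proof (rule integrable_const_bound[where B="(real n)\<^sup>2"])
    show "AE x in M. norm ((?S n x)\<^sup>2) \<le> (real n)\<^sup>2"
      using power_mono[OF S_le abs_ge_zero, where n=2] by simp
  qed measurable
  have "(\<integral>x. \<bar>?S n x / real n\<bar> \<partial>M) \<le> 1 / sqrt (real n)" if "n > 0" for n
  proof -
    have "(\<integral>x. \<bar>?S n x / real n\<bar> \<partial>M) = (\<integral>x. \<bar>?S n x\<bar> \<partial>M) / real n" by simp
    also have "\<dots> \<le> sqrt (\<integral>x. (?S n x)\<^sup>2 \<partial>M) / real n"
      by (intro divide_right_mono integral_abs_le_sqrt int int2) simp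
    also have "\<dots> \<le> sqrt (real n) / real n"
      by (intro divide_right_mono real_sqrt_le_mono integral_square_sum_innovations h) simp
    also have "\<dots> = 1 / sqrt (real n)" using that by (simp add: real_div_sqrt field_simps)
    finally show ?thesis .
  qed
  then have "norm (\<integral>x. \<bar>?S n x / real n\<bar> \<partial>M) \<le> 1 / sqrt (real n)" if "n > 0" for n
    using that by (simp del: abs_divide)
  then show "eventually (\<lambda>n. norm (\<integral>x. \<bar>?S n x / real n\<bar> \<partial>M) \<le> 1 / sqrt (real n)) sequentially"
    by (rule eventually_mono[OF eventually_gt_at_top[of 0]])
  show "(\<lambda>n. 1 / sqrt (real n)) \<longlonglongrightarrow> 0"
    by (intro tendsto_divide_0[OF tendsto_const] filterlim_at_top_imp_at_infinity
      filterlim_compose[OF sqrt_at_top] filterlim_real_sequentially)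
qed

text \<open>A guess that maximizes an estimate \<open>p\<close> of the conditional distribution may differ from the optimal
  guess even when \<open>p\<close> is very accurate, namely when there is almost a tie. What stays small is
  the excess probability of an error: from \<open>p b \<le> p h\<close> it is at most the sum of the
  estimation errors at \<open>b\<close> and at \<open>h\<close>.\<close>

lemma regret_le_estimation_error:
  assumes h: "\<And>y. p y \<le> p (h::'b)"
  shows "q b x - q h x \<le> 2 * (\<Sum>y\<in>UNIV. \<bar>p y - q y x\<bar>)"
proof -
  have "\<bar>p y - q y x\<bar> \<le> (\<Sum>y\<in>UNIV. \<bar>p y - q y x\<bar>)" for y
    by (rule member_le_sum) auto
  from this[of b] this[of h] h[of b] show ?thesis by linarith
qed

end

locale ergodic_prediction = stationary_prediction + ergodic_map
begin

text \<open>The error indicator at time \<open>t\<close> is the sum of an innovation, of the regret \<open>q (b x) x - q (h t x) x\<close>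
  and of the minimal conditional error probability \<open>1 - q (b x) x\<close>, all evaluated at the shifted
  point. Averages of innovations vanish by orthogonality, averages of regrets because by invariance
  of the measure their integrals are those of the unshifted regrets, which tend to 0, and the last
  term is averaged by the ergodic theorem.\<close>

theorem prediction_error_rate:
  fixes p :: "nat \<Rightarrow> 'b \<Rightarrow> 'a \<Rightarrow> real"
  assumes p_int: "\<And>t y. integrable M (p t y)"
    and consistent: "\<And>y. (\<lambda>t. \<integral>x. \<bar>p t y x - q y x\<bar> \<partial>M) \<longlonglongrightarrow> 0"
    and h [measurable]: "\<And>t. h t \<in> F \<rightarrow>\<^sub>M count_space UNIV"
    and h_max: "\<And>t x y. p t y x \<le> p t (h t x) x"
    and b [measurable]: "b \<in> F \<rightarrow>\<^sub>M count_space UNIV"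
    and b_max: "\<And>x y. q y x \<le> q (b x) x"
  shows "(\<lambda>n. \<integral>x. \<bar>(\<Sum>t<n. of_bool (Y ((T ^^ t) x) \<noteq> h t ((T ^^ t) x))) / real n
      - prob {x \<in> space M. Y x \<noteq> b x}\<bar> \<partial>M) \<longlonglongrightarrow> 0"
proof -
  note past_measurable[OF h, measurable] past_measurable[OF b, measurable]
    past_measurable[OF q_at_past[OF h], measurable] past_measurable[OF q_at_past[OF b], measurable]
    innovation_measurable[OF h, measurable]
  define r where "r t x = q (b x) x - q (h t x) x" for t x
  define e where "e x = 1 - q (b x) x" for x
  have [measurable]: "r t \<in> borel_measurable M" "e \<in> borel_measurable M" for t
    unfolding r_def e_def by measurable
  have r_nonneg: "0 \<le> r t x" for t x using b_max by (simp add: r_def)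
  have e_bound: "\<bar>e x\<bar> \<le> 1" for x
    using q_nonneg q_le_1 by (simp add: e_def)
  have r_bound: "\<bar>r t x\<bar> \<le> 1" for t x
    using q_nonneg[of "b x" x] q_le_1[of "b x" x] q_nonneg[of "h t x" x] q_le_1[of "h t x" x]
    by (simp add: r_def)
  have r_int: "integrable M (r t)" and r_int': "integrable M (\<lambda>x. r t ((T ^^ t') x))" for t t'
    by (rule integrable_const_bound[where B=1]; use r_bound in simp)+
  have e_int: "integrable M e"
    by (rule integrable_const_bound[where B=1]) (use e_bound in auto)
  have i_int: "integrable M (\<lambda>x. innovation (h t) ((T ^^ t') x))" for t t'
    by (rule integrable_const_bound[where B=1]) (use abs_innovation_le_1 in auto)
  have o_int: "integrable M (orbit_sum e n)" for n
    unfolding orbit_sum_def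
    by (intro Bochner_Integration.integrable_sum integrable_const_bound[where B=1])
      (use e_bound in auto)
  have expect_e: "(\<integral>x. e x \<partial>M) = prob {x \<in> space M. Y x \<noteq> b x}"
  proof -
    have "(\<integral>x. innovation b x \<partial>M) = 0"
      using integral_past_times_innovation[of "\<lambda>_. 1" 1 b] b by simp
    moreover have "(\<integral>x. innovation b x \<partial>M) = (\<integral>x. of_bool (Y x \<noteq> b x) - e x \<partial>M)"
      by (simp add: innovation_def e_def)
    moreover have "integrable M (\<lambda>x. of_bool (Y x \<noteq> b x) :: real)"
      by (rule integrable_const_bound[where B=1]) auto
    moreover have "(\<integral>x. of_bool (Y x \<noteq> b x) \<partial>M) = prob {x \<in> space M. Y x \<noteq> b x}"
    proof -
      have "(\<integral>x. of_bool (Y x \<noteq> b x) \<partial>M) =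
          (\<integral>x. indicator {x \<in> space M. Y x \<noteq> b x} x \<partial>M :: real)"
        by (intro Bochner_Integration.integral_cong) auto
      also have "\<dots> = prob {x \<in> space M. Y x \<noteq> b x}" by simp
      finally show ?thesis .
    qed
    ultimately show ?thesis using e_int by simp
  qed
  let ?I = "\<integral>x. e x \<partial>M"
  let ?A = "\<lambda>n x. \<bar>(\<Sum>t<n. innovation (h t) ((T ^^ t) x)) / real n\<bar>"
  let ?B = "\<lambda>n x. (\<Sum>t<n. r t ((T ^^ t) x)) / real n"
  let ?C = "\<lambda>n x. \<bar>orbit_sum e n x / real n - ?I\<bar>"
  have "(\<lambda>t. \<integral>x. r t x \<partial>M) \<longlonglongrightarrow> 0"
  proof (rule tendsto_sandwich[OF _ _ tendsto_const])
    show "eventually (\<lambda>t. 0 \<le> (\<integral>x. r t x \<partial>M)) sequentially"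
      by (simp add: r_nonneg)
    have abs_int: "integrable M (\<lambda>x. \<bar>p t y x - q y x\<bar>)" for t y
      using p_int integrable_const_bound[of "q y" 1] q_nonneg q_le_1 by simp
    have "(\<integral>x. r t x \<partial>M) \<le> 2 * (\<Sum>y\<in>UNIV. \<integral>x. \<bar>p t y x - q y x\<bar> \<partial>M)" for t
    proof -
      have "(\<integral>x. r t x \<partial>M) \<le> (\<integral>x. 2 * (\<Sum>y\<in>UNIV. \<bar>p t y x - q y x\<bar>) \<partial>M)"
      proof (rule integral_mono[OF r_int])
        show "r t x \<le> 2 * (\<Sum>y\<in>UNIV. \<bar>p t y x - q y x\<bar>)" for x
          unfolding r_def using h_max by (rule regret_le_estimation_error)
      qed (simp add: abs_int)
      then show ?thesis by (simp add: abs_int)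
    qed
    then show "eventually (\<lambda>t. (\<integral>x. r t x \<partial>M) \<le>
        2 * (\<Sum>y\<in>UNIV. \<integral>x. \<bar>p t y x - q y x\<bar> \<partial>M)) sequentially" by simp
    have "(\<lambda>t. 2 * (\<Sum>y\<in>UNIV. \<integral>x. \<bar>p t y x - q y x\<bar> \<partial>M)) \<longlonglongrightarrow> 2 * (\<Sum>y\<in>(UNIV::'b set). 0)"
      by (rule tendsto_mult_left, rule tendsto_sum, rule consistent)
    then show "(\<lambda>t. 2 * (\<Sum>y\<in>UNIV. \<integral>x. \<bar>p t y x - q y x\<bar> \<partial>M)) \<longlonglongrightarrow> 0" by simp
  qed
  moreover have B_eq: "(\<integral>x. ?B n x \<partial>M) = (\<Sum>t<n. \<integral>x. r t x \<partial>M) / real n" for n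
    by (simp add: r_int' integral_funpow_T)
  ultimately have B_lim: "(\<lambda>n. \<integral>x. ?B n x \<partial>M) \<longlonglongrightarrow> 0"
    unfolding B_eq by (intro cesaro_mean_tendsto_zero)
  show ?thesis
  proof (rule Lim_null_comparison)
    let ?L = "\<lambda>n x. \<bar>(\<Sum>t<n. of_bool (Y ((T ^^ t) x) \<noteq> h t ((T ^^ t) x))) / real n
      - prob {x \<in> space M. Y x \<noteq> b x}\<bar>"
    have "of_bool (Y x \<noteq> h t x) = innovation (h t) x + r t x + e x" for t x
      by (simp add: innovation_def r_def e_def)
    then have split: "(\<Sum>t<n. of_bool (Y ((T ^^ t) x) \<noteq> h t ((T ^^ t) x))) =
        (\<Sum>t<n. innovation (h t) ((T ^^ t) x)) + (\<Sum>t<n. r t ((T ^^ t) x)) + orbit_sum e n x" for n x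
      by (simp add: sum.distrib orbit_sum_def)
    have le: "?L n x \<le> ?A n x + ?B n x + ?C n x" for n x
    proof -
      have "0 \<le> ?B n x" using r_nonneg by (simp add: sum_nonneg)
      then show ?thesis
        unfolding split expect_e[symmetric] add_divide_distrib by linarith
    qed
    have int: "integrable M (\<lambda>x. ?A n x)" "integrable M (\<lambda>x. ?B n x)" "integrable M (\<lambda>x. ?C n x)" for n
      by (intro integrable_abs Bochner_Integration.integrable_diff integrable_divide
          Bochner_Integration.integrable_sum
          i_int r_int' o_int integrable_const)+
    have "(\<integral>x. ?L n x \<partial>M) \<le> (\<integral>x. ?A n x + ?B n x + ?C n x \<partial>M)" for n
    proof (rule integral_mono[OF _ _ le])
      show "integrable M (\<lambda>x. ?L n x)"
        unfolding split add_divide_distrib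
        by (intro integrable_abs Bochner_Integration.integrable_diff
            Bochner_Integration.integrable_add integrable_divide
            Bochner_Integration.integrable_sum i_int r_int' o_int integrable_const)
    qed (intro Bochner_Integration.integrable_add int)
    then have "(\<integral>x. ?L n x \<partial>M) \<le> (\<integral>x. ?A n x \<partial>M) + (\<integral>x. ?B n x \<partial>M) + (\<integral>x. ?C n x \<partial>M)" for n
      using int by (simp del: abs_divide)
    then show "eventually (\<lambda>n. norm (\<integral>x. ?L n x \<partial>M) \<le>
        (\<integral>x. ?A n x \<partial>M) + (\<integral>x. ?B n x \<partial>M) + (\<integral>x. ?C n x \<partial>M)) sequentially"
      by (simp del: abs_divide)
    have "(\<lambda>n. \<integral>x. ?C n x \<partial>M) \<longlonglongrightarrow> 0"
      using e_bound by (intro mean_ergodic_theorem_bounded[where B=1]) auto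
    then have "(\<lambda>n. (\<integral>x. ?A n x \<partial>M) + (\<integral>x. ?B n x \<partial>M) + (\<integral>x. ?C n x \<partial>M)) \<longlonglongrightarrow> 0 + 0 + 0"
      using B_lim innovation_average_tendsto_0[OF h] by (intro tendsto_add)
    then show "(\<lambda>n. (\<integral>x. ?A n x \<partial>M) + (\<integral>x. ?B n x \<partial>M) + (\<integral>x. ?C n x \<partial>M)) \<longlonglongrightarrow> 0" by simp
  qed
qed

end

section \<open>Maximizers with ties\<close>

lemma arg_max_by_max:
  fixes f :: "'a::finite \<Rightarrow> real"
  assumes "tie_breaking_rule tie"
  shows "f y \<le> f (arg_max_by tie f)"
proof -
  have "Max (range f) \<in> range f" by (rule Max_in) auto
  then obtain x where x: "f x = Max (range f)" by force
  have "f y \<le> f x" for y unfolding x by (rule Max_ge) auto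
  then have "is_arg_max f (\<lambda>_. True) x" by (simp add: is_arg_max_linorder)
  then have "{x. is_arg_max f (\<lambda>_. True) x} \<noteq> {}" by auto
  with assms have "arg_max_by tie f \<in> {x. is_arg_max f (\<lambda>_. True) x}"
    unfolding tie_breaking_rule_def arg_max_by_def by (elim allE impE)
  then show ?thesis by (simp add: is_arg_max_linorder)
qed

text \<open>Whatever the tie-breaking rule, the chosen maximizer is a function of the set of all maximizers,
  which takes finitely many values.\<close>

lemma measurable_arg_max_by:
  fixes p :: "'a::finite \<Rightarrow> 'w \<Rightarrow> real"
  assumes [measurable]: "\<And>y. p y \<in> borel_measurable N"
  shows "(\<lambda>\<omega>. arg_max_by tie (\<lambda>y. p y \<omega>)) \<in> N \<rightarrow>\<^sub>M count_space UNIV"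
proof -
  let ?S = "\<lambda>\<omega>. {x. is_arg_max (\<lambda>y. p y \<omega>) (\<lambda>_. True) x}"
  have "?S \<in> N \<rightarrow>\<^sub>M count_space UNIV"
  proof (subst measurable_count_space_eq2, simp, intro conjI ballI)
    fix A :: "'a set"
    have "?S -` {A} \<inter> space N = {\<omega> \<in> space N. \<forall>x. (\<forall>y. p y \<omega> \<le> p x \<omega>) = (x \<in> A)}"
      by (auto simp: is_arg_max_linorder)
    also have "\<dots> \<in> sets N" by measurable
    finally show "?S -` {A} \<inter> space N \<in> sets N" .
  qed simp
  then show ?thesis unfolding arg_max_by_def by (rule measurable_compose) simp
qed

section \<open>The past of a process and its law\<close>

lemma measurable_past_coordinate:
  assumes "s < 0"
  shows "X s \<in> past_algebra M X \<rightarrow>\<^sub>M count_space UNIV"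
proof -
  have "(\<lambda>\<omega>. \<lambda>t\<in>{..<0}. X t \<omega>) \<in> past_algebra M X \<rightarrow>\<^sub>M Pi\<^sub>M {..<0} (\<lambda>_. count_space UNIV)"
    unfolding past_algebra_def by (rule measurable_vimage_algebra1) (auto simp: space_PiM)
  then have "(\<lambda>\<omega>. (\<lambda>t\<in>{..<0}. X t \<omega>) s) \<in> past_algebra M X \<rightarrow>\<^sub>M count_space UNIV"
    by (rule measurable_compose[OF _ measurable_component_singleton]) (use assms in simp)
  then show ?thesis using assms by simp
qed

lemma measurable_into_past_algebra:
  assumes "g \<in> space N \<rightarrow> space M"
    and "\<And>s. s < 0 \<Longrightarrow> (\<lambda>x. X s (g x)) \<in> N \<rightarrow>\<^sub>M count_space UNIV"
  shows "g \<in> N \<rightarrow>\<^sub>M past_algebra M X"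
  unfolding past_algebra_def
  by (rule measurable_vimage_algebra2[OF assms(1)], rule measurable_restrict) (auto intro: assms(2))

lemma measurable_block:
  fixes X :: "int \<Rightarrow> 'w \<Rightarrow> 'a::countable"
  assumes "\<And>i. i < t \<Longrightarrow> X (s + int i) \<in> N \<rightarrow>\<^sub>M count_space UNIV"
  shows "block X s t \<in> N \<rightarrow>\<^sub>M count_space UNIV"
  using assms
proof (induction t)
  case 0
  then show ?case by (simp add: block_def[abs_def])
next
  case (Suc t)
  have "block X s (Suc t) = (\<lambda>\<omega>. block X s t \<omega> @ [X (s + int t) \<omega>])"
    by (simp add: block_def fun_eq_iff)
  also have "\<dots> \<in> N \<rightarrow>\<^sub>M count_space UNIV"
  proof (rule measurable_compose_countable[where f="\<lambda>l \<omega>. l @ [X (s + int t) \<omega>]"])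
    show "block X s t \<in> N \<rightarrow>\<^sub>M count_space UNIV" using Suc by simp
    show "(\<lambda>\<omega>. l @ [X (s + int t) \<omega>]) \<in> N \<rightarrow>\<^sub>M count_space UNIV" for l
      by (rule measurable_compose[OF Suc.prems[of t]]) simp_all
  qed
  finally show ?case .
qed

lemma funpow_shift: "(shift ^^ t) \<omega> = (\<lambda>s. \<omega> (s + int t))"
  by (induction t) (simp_all add: shift_def algebra_simps)

lemma past_cond_prob_bounds:
  assumes X: "random_process M X"
  shows "AE \<omega> in M. 0 \<le> past_cond_prob M X x \<omega> \<and> past_cond_prob M X x \<omega> \<le> 1"
proof -
  interpret prob_space M using X by (simp add: random_process_def)
  interpret finite_measure_subalgebra M "past_algebra M X"
    by unfold_locales (rule subalgebra_past_algebra[OF X])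
  have [measurable]: "X t \<in> M \<rightarrow>\<^sub>M count_space UNIV" for t using X by (simp add: random_process_def)
  have int: "integrable M (\<lambda>\<omega>. of_bool (X 0 \<omega> = x) :: real)"
    by (rule integrable_const_bound[where B=1]) auto
  have "AE \<omega> in M. 0 \<le> past_cond_prob M X x \<omega>"
    unfolding past_cond_prob_def by (rule real_cond_exp_ge_c[OF int]) simp
  moreover have "AE \<omega> in M. past_cond_prob M X x \<omega> \<le> 1"
    unfolding past_cond_prob_def by (rule real_cond_exp_le_c[OF int]) simp
  ultimately show ?thesis by eventually_elim simp
qed

lemma random_process_coordinates:
  assumes "prob_space P" and sets_P [measurable_cong]: "sets P = sets path_space"
  shows "random_process P (\<lambda>t \<omega>. \<omega> t)"
  unfolding random_process_def
proof (intro conjI allI assms(1))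
  show "(\<lambda>\<omega>. \<omega> t) \<in> P \<rightarrow>\<^sub>M count_space UNIV" for t by measurable
qed

lemma measurable_path:
  assumes "random_process M X"
  shows "(\<lambda>\<omega> t. X t \<omega>) \<in> M \<rightarrow>\<^sub>M path_space"
  using assms by (intro measurable_PiM_single') (auto simp: random_process_def)

text \<open>Conditioning on the past commutes with passing from the process to its law, because the events of
  the past of the process are exactly the preimages of those of the past on path space.\<close>

lemma past_cond_prob_process_distribution:
  assumes X: "random_process M X"
  shows "AE \<omega> in M. past_cond_prob M X x \<omega> =
    past_cond_prob (process_distribution M X) (\<lambda>t \<omega>. \<omega> t) x (\<lambda>t. X t \<omega>)"
proof -
  define P where "P = process_distribution M X"
  let ?path = "\<lambda>\<omega> t. X t \<omega>" and ?Y = "\<lambda>t \<omega>. \<omega> t :: 'b"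
  let ?c = "past_cond_prob P ?Y x"
  interpret prob_space M using X by (simp add: random_process_def)
  interpret finite_measure_subalgebra M "past_algebra M X"
    by unfold_locales (rule subalgebra_past_algebra[OF X])
  have X_meas [measurable]: "X t \<in> M \<rightarrow>\<^sub>M count_space UNIV" for t
    using X by (simp add: random_process_def)
  note path [measurable] = measurable_path[OF X]
  have sets_P [measurable_cong]: "sets P = sets path_space"
    by (simp add: P_def process_distribution_def)
  have space_P: "space P = UNIV"
    using sets_eq_imp_space_eq[OF sets_P] by (simp add: space_PiM)
  interpret P: prob_space P
    unfolding P_def process_distribution_def by (rule prob_space_distr[OF path])
  have Y: "random_process P ?Y"
    using P.prob_space_axioms sets_P by (rule random_process_coordinates)
  interpret P: finite_measure_subalgebra P "past_algebra P ?Y"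
    by unfold_locales (rule subalgebra_past_algebra[OF Y])
  have path_past: "?path \<in> past_algebra M X \<rightarrow>\<^sub>M past_algebra P ?Y"
    by (rule measurable_into_past_algebra) (auto simp: space_P measurable_past_coordinate)
  have c_past: "?c \<in> borel_measurable (past_algebra P ?Y)"
    unfolding past_cond_prob_def by simp
  have c [measurable]: "?c \<in> borel_measurable P"
    unfolding past_cond_prob_def by simp
  have int_P: "integrable P (\<lambda>\<omega>. of_bool (\<omega> 0 = x) :: real)"
    by (rule P.integrable_const_bound[where B=1]) auto
  have int_c: "integrable P ?c" unfolding past_cond_prob_def by (rule P.real_cond_exp_int(1)[OF int_P])
  have P_distr: "P = distr M P ?path"
    unfolding P_def process_distribution_def by (rule distr_cong) auto
  have path_P [measurable]: "?path \<in> M \<rightarrow>\<^sub>M P" by measurable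
  have transfer: "(\<integral>\<omega>. f (?path \<omega>) \<partial>M) = (\<integral>\<omega>. f \<omega> \<partial>P)" if "f \<in> borel_measurable P" for f :: "_ \<Rightarrow> real"
    using integral_distr[OF path_P that] P_distr by simp
  show ?thesis
    unfolding past_cond_prob_def[of M] P_def[symmetric]
  proof (rule real_cond_exp_charact)
    fix A assume "A \<in> sets (past_algebra M X)"
    then obtain B where B: "B \<in> sets (Pi\<^sub>M {..<0} (\<lambda>_. count_space UNIV))"
      and A: "A = (\<lambda>\<omega>. \<lambda>t\<in>{..<0}. X t \<omega>) -` B \<inter> space M"
      unfolding past_algebra_def by (subst (asm) sets_vimage_algebra2) (auto simp: space_PiM)
    define A' where "A' = (\<lambda>\<omega>. \<lambda>t\<in>{..<0}. \<omega> t :: 'b) -` B \<inter> space P"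
    have A': "A' \<in> sets (past_algebra P ?Y)"
      unfolding A'_def past_algebra_def using B by (rule in_vimage_algebra)
    have [measurable]: "A' \<in> sets P"
      using A' subalgebra_past_algebra[OF Y] by (auto simp: subalgebra_def)
    have ind: "indicator A \<omega> = (indicator A' (?path \<omega>) :: real)" if "\<omega> \<in> space M" for \<omega>
      using that by (simp add: A A'_def space_P indicator_def)
    have "(\<integral>\<omega>\<in>A. of_bool (X 0 \<omega> = x) \<partial>M) =
        (\<integral>\<omega>. indicator A' (?path \<omega>) * of_bool (?path \<omega> 0 = x) \<partial>M :: real)"
      unfolding set_lebesgue_integral_def by (intro Bochner_Integration.integral_cong) (auto simp: ind)
    also have "\<dots> = (\<integral>\<omega>. indicator A' \<omega> * of_bool (\<omega> 0 = x) \<partial>P)"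
      by (rule transfer) measurable
    also have "\<dots> = (\<integral>\<omega>. indicator A' \<omega> * ?c \<omega> \<partial>P)"
      using P.real_cond_exp_intA[OF int_P A'] by (simp add: set_lebesgue_integral_def past_cond_prob_def)
    also have "\<dots> = (\<integral>\<omega>. indicator A' (?path \<omega>) * ?c (?path \<omega>) \<partial>M)"
      by (rule transfer[symmetric]) measurable
    also have "\<dots> = (\<integral>\<omega>\<in>A. ?c (?path \<omega>) \<partial>M)"
      unfolding set_lebesgue_integral_def by (intro Bochner_Integration.integral_cong) (auto simp: ind)
    finally show "(\<integral>\<omega>\<in>A. of_bool (X 0 \<omega> = x) \<partial>M) = (\<integral>\<omega>\<in>A. ?c (?path \<omega>) \<partial>M)" .
  next
    show "integrable M (\<lambda>\<omega>. of_bool (X 0 \<omega> = x) :: real)"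
      by (rule integrable_const_bound[where B=1]) auto
    show "integrable M (\<lambda>\<omega>. ?c (?path \<omega>))"
      using int_c P_distr integrable_distr[OF path_P] by metis
    show "(\<lambda>\<omega>. ?c (?path \<omega>)) \<in> borel_measurable (past_algebra M X)"
      by (rule measurable_compose[OF path_past c_past])
  qed
qed

section \<open>The rate of errors of the online predictor\<close>

text \<open>For the coordinate process the shift plays the role of \<open>T\<close>. This is where consistency of the
  estimates enters, since consistency speaks of the past of length \<open>t\<close> before time 0.\<close>

lemma prediction_error_rate_path_space:
  fixes Q :: "'a::finite list \<Rightarrow> 'a pmf" and P :: "(int \<Rightarrow> 'a) measure"
  assumes Q: "weakly_consistent Q" and tie: "tie_breaking_rule tie"
    and stat: "stationary_distribution P" and erg: "ergodic_distribution P"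
  defines "Y \<equiv> \<lambda>t \<omega>. \<omega> t"
  shows "(\<lambda>n. \<integral>\<omega>. \<bar>(\<Sum>t<n. of_bool (\<omega> (int t) \<noteq> online_predictor tie Q Y t \<omega>)) / real n
      - measure P {\<omega> \<in> space P. \<omega> 0 \<noteq> best_predictor tie P Y \<omega>}\<bar> \<partial>P) \<longlonglongrightarrow> 0"
proof -
  interpret P: prob_space P using stat by (simp add: stationary_distribution_def)
  have sets_P [measurable_cong]: "sets P = sets path_space"
    using stat by (simp add: stationary_distribution_def)
  have space_P: "space P = UNIV"
    using sets_eq_imp_space_eq[OF sets_P] by (simp add: space_PiM)
  have Y_P [measurable]: "Y t \<in> P \<rightarrow>\<^sub>M count_space UNIV" for t unfolding Y_def by measurable
  have Y: "random_process P Y"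
    unfolding Y_def using P.prob_space_axioms sets_P by (rule random_process_coordinates)
  interpret P: finite_measure_subalgebra P "past_algebra P Y"
    by unfold_locales (rule subalgebra_past_algebra[OF Y])
  define U :: "(int \<Rightarrow> 'a) \<Rightarrow> int \<Rightarrow> 'a" where "U \<omega> = (\<lambda>t. \<omega> (t - 1))" for \<omega>
  \<comment> \<open>A conditional probability lies in \<open>[0, 1]\<close> only almost everywhere; truncation makes the bounds
    hold everywhere.\<close>
  define q where "q y \<omega> = max 0 (min 1 (past_cond_prob P Y y \<omega>))" for y \<omega>
  have past_coord: "(\<lambda>\<omega>. \<omega> s) \<in> past_algebra P Y \<rightarrow>\<^sub>M count_space UNIV" if "s < 0" for s
    using measurable_past_coordinate[OF that, of Y P] by (simp add: Y_def)
  have q: "AE \<omega> in P. \<forall>y. q y \<omega> = past_cond_prob P Y y \<omega>"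
    unfolding AE_all_countable
  proof
    show "AE \<omega> in P. q y \<omega> = past_cond_prob P Y y \<omega>" for y
      using past_cond_prob_bounds[OF Y, where x=y] by eventually_elim (simp add: q_def)
  qed
  have q_past: "q y \<in> borel_measurable (past_algebra P Y)" for y
    unfolding q_def past_cond_prob_def by measurable
  have [measurable]: "shift \<in> P \<rightarrow>\<^sub>M P"
    unfolding measurable_cong_sets[OF sets_P sets_P] shift_def
    by (intro measurable_PiM_single') (auto intro: measurable_component_singleton)
  interpret ergodic_prediction P shift U "past_algebra P Y" "Y 0" q
  proof unfold_locales
    show "distr P P shift = P"
      using stat distr_cong[OF refl sets_P, of P shift shift] by (simp add: stationary_distribution_def)
    show "P.prob A = 0 \<or> P.prob A = 1" if "A \<in> sets P" "shift -` A \<inter> space P = A" for A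
      using erg that by (simp add: ergodic_distribution_def sets_P space_P)
    show "subalgebra P (past_algebra P Y)" by (rule subalgebra_past_algebra[OF Y])
    show "U \<in> past_algebra P Y \<rightarrow>\<^sub>M past_algebra P Y"
    proof (rule measurable_into_past_algebra)
      show "(\<lambda>\<omega>. Y s (U \<omega>)) \<in> past_algebra P Y \<rightarrow>\<^sub>M count_space UNIV" if "s < 0" for s
        using past_coord[of "s - 1"] that by (simp add: Y_def U_def)
    qed (simp add: space_P)
    show "(\<lambda>\<omega>. Y 0 (U \<omega>)) \<in> past_algebra P Y \<rightarrow>\<^sub>M count_space UNIV"
      using past_coord[of "-1"] by (simp add: Y_def U_def)
    show "AE \<omega> in P. q y \<omega> = real_cond_exp P (past_algebra P Y) (\<lambda>\<omega>. of_bool (Y 0 \<omega> = y)) \<omega>" for y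
      using q by eventually_elim (simp add: past_cond_prob_def)
    show "U (shift \<omega>) = \<omega>" for \<omega> by (simp add: U_def shift_def)
    show "0 \<le> q y \<omega>" "q y \<omega> \<le> 1" for y \<omega> by (simp_all add: q_def)
  qed (fact q_past Y_P \<open>shift \<in> P \<rightarrow>\<^sub>M P\<close>)+
  define p where "p t y \<omega> = pmf (Q (block Y (- int t) t \<omega>)) y" for t y \<omega>
  define h where "h t \<omega> = arg_max_by tie (\<lambda>y. p t y \<omega>)" for t \<omega>
  define b where "b \<omega> = arg_max_by tie (\<lambda>y. q y \<omega>)" for \<omega>
  have block_past: "block Y (- int t) t \<in> past_algebra P Y \<rightarrow>\<^sub>M count_space UNIV" for t
    by (rule measurable_block, rule measurable_past_coordinate) simp
  have p_past: "p t y \<in> borel_measurable (past_algebra P Y)" for t y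
    unfolding p_def by (rule measurable_compose[OF block_past]) simp
  have p_P: "p t y \<in> borel_measurable P" for t y
    by (rule past_measurable) (rule p_past)
  have b_past: "b \<in> past_algebra P Y \<rightarrow>\<^sub>M count_space UNIV"
    unfolding b_def by (intro measurable_arg_max_by q_past)
  have rate: "(\<lambda>n. \<integral>\<omega>. \<bar>(\<Sum>t<n. of_bool (Y 0 ((shift ^^ t) \<omega>) \<noteq> h t ((shift ^^ t) \<omega>))) / real n
      - P.prob {\<omega> \<in> space P. Y 0 \<omega> \<noteq> b \<omega>}\<bar> \<partial>P) \<longlonglongrightarrow> 0"
  proof (rule prediction_error_rate)
    show "integrable P (p t y)" for t y
      by (rule P.integrable_const_bound[where B=1])
        (simp_all add: p_P, simp add: p_def pmf_le_1)
    show "h t \<in> past_algebra P Y \<rightarrow>\<^sub>M count_space UNIV" for t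
      unfolding h_def by (intro measurable_arg_max_by p_past)
    show "p t y \<omega> \<le> p t (h t \<omega>) \<omega>" for t \<omega> y
      unfolding h_def using tie by (rule arg_max_by_max[where f="\<lambda>y. p t y \<omega>"])
    show "q y \<omega> \<le> q (b \<omega>) \<omega>" for \<omega> y
      unfolding b_def using tie by (rule arg_max_by_max[where f="\<lambda>y. q y \<omega>"])
    have "L1_convergent_to P (\<lambda>t \<omega>. p t y \<omega>) (past_cond_prob P Y y)" for y
      using Q stat unfolding weakly_consistent_def Let_def p_def Y_def by blast
    then have "(\<lambda>t. \<integral>\<omega>. \<bar>p t y \<omega> - past_cond_prob P Y y \<omega>\<bar> \<partial>P) \<longlonglongrightarrow> 0" for y
      by (simp add: L1_convergent_to_def)
    moreover have "(\<integral>\<omega>. \<bar>p t y \<omega> - q y \<omega>\<bar> \<partial>P) = (\<integral>\<omega>. \<bar>p t y \<omega> - past_cond_prob P Y y \<omega>\<bar> \<partial>P)" for t y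
    proof (rule integral_cong_AE)
      show "AE \<omega> in P. \<bar>p t y \<omega> - q y \<omega>\<bar> = \<bar>p t y \<omega> - past_cond_prob P Y y \<omega>\<bar>"
        using q by eventually_elim simp
      show "(\<lambda>\<omega>. \<bar>p t y \<omega> - past_cond_prob P Y y \<omega>\<bar>) \<in> borel_measurable P"
        using p_P unfolding past_cond_prob_def by measurable
    qed (use p_P in measurable)
    ultimately show "(\<lambda>t. \<integral>\<omega>. \<bar>p t y \<omega> - q y \<omega>\<bar> \<partial>P) \<longlonglongrightarrow> 0" for y by simp
  qed (fact b_past)
  \<comment> \<open>The block observed at time \<open>t\<close> is the recent past as seen after shifting time \<open>t\<close> to the origin.\<close>
  have "block Y (- int t) t ((shift ^^ t) \<omega>) = block Y 0 t \<omega>" for t \<omega>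
    by (simp add: block_def Y_def funpow_shift)
  then have online: "h t ((shift ^^ t) \<omega>) = online_predictor tie Q Y t \<omega>" for t \<omega>
    by (simp add: h_def p_def online_predictor_def)
  have prob: "P.prob {\<omega> \<in> space P. Y 0 \<omega> \<noteq> b \<omega>} =
      P.prob {\<omega> \<in> space P. Y 0 \<omega> \<noteq> best_predictor tie P Y \<omega>}"
  proof (rule P.finite_measure_eq_AE)
    show "AE \<omega> in P. (\<omega> \<in> {\<omega> \<in> space P. Y 0 \<omega> \<noteq> b \<omega>}) =
        (\<omega> \<in> {\<omega> \<in> space P. Y 0 \<omega> \<noteq> best_predictor tie P Y \<omega>})"
      using q by eventually_elim (simp add: b_def best_predictor_def)
    have [measurable]: "best_predictor tie P Y \<in> P \<rightarrow>\<^sub>M count_space UNIV"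
      unfolding best_predictor_def by (rule measurable_arg_max_by) (simp add: past_cond_prob_def)
    have [measurable]: "b \<in> P \<rightarrow>\<^sub>M count_space UNIV" by (rule past_measurable[OF b_past])
    show "{\<omega> \<in> space P. Y 0 \<omega> \<noteq> b \<omega>} \<in> sets P" by measurable
    show "{\<omega> \<in> space P. Y 0 \<omega> \<noteq> best_predictor tie P Y \<omega>} \<in> sets P" by measurable
  qed
  show ?thesis
    using rate unfolding online prob by (simp add: Y_def funpow_shift)
qed

text \<open>Everything in the statement is a function of the path of the process, up to the choice of a version of
  the conditional probabilities, so the result transfers from path space by a change of variables.\<close>

theorem theorem7:
  fixes Q :: "'a::finite list \<Rightarrow> 'a pmf"
    and tie :: "'a set \<Rightarrow> 'a"
    and M :: "'w measure"
    and X :: "int \<Rightarrow> 'w \<Rightarrow> 'a"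
  assumes "weakly_consistent Q"
    and "tie_breaking_rule tie"
    and "random_process M X"
    and "stationary_distribution (process_distribution M X)"
    and "ergodic_distribution (process_distribution M X)"
  shows "L1_convergent_to M
           (\<lambda>n \<omega>. (\<Sum>t<n. of_bool (X (int t) \<omega> \<noteq> online_predictor tie Q X t \<omega>)) / real n)
           (\<lambda>_. \<P>(\<omega> in M. X 0 \<omega> \<noteq> best_predictor tie M X \<omega>))"
proof -
  define P where "P = process_distribution M X"
  let ?path = "\<lambda>\<omega> t. X t \<omega>" and ?Y = "\<lambda>t \<omega>. \<omega> t :: 'a"
  interpret prob_space M using assms(3) by (simp add: random_process_def)
  interpret finite_measure_subalgebra M "past_algebra M X"
    by unfold_locales (rule subalgebra_past_algebra[OF assms(3)])
  have [measurable]: "X t \<in> M \<rightarrow>\<^sub>M count_space UNIV" for t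
    using assms(3) by (simp add: random_process_def)
  have sets_P [measurable_cong]: "sets P = sets path_space"
    by (simp add: P_def process_distribution_def)
  have space_P: "space P = UNIV"
    using sets_eq_imp_space_eq[OF sets_P] by (simp add: space_PiM)
  note measurable_path[OF assms(3), measurable]
  have path_P [measurable]: "?path \<in> M \<rightarrow>\<^sub>M P" by measurable
  have P_distr: "P = distr M P ?path"
    unfolding P_def process_distribution_def by (rule distr_cong) auto
  have online [measurable]: "online_predictor tie Q ?Y t \<in> P \<rightarrow>\<^sub>M count_space UNIV" for t
  proof -
    have [measurable]: "block ?Y 0 t \<in> P \<rightarrow>\<^sub>M count_space UNIV"
      by (rule measurable_block) measurable
    show ?thesis unfolding online_predictor_def by measurable
  qed
  have online_path: "online_predictor tie Q X t \<omega> = online_predictor tie Q ?Y t (?path \<omega>)" for t \<omega>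
    by (simp add: online_predictor_def block_def)
  let ?R = "\<P>(\<omega> in M. X 0 \<omega> \<noteq> best_predictor tie M X \<omega>)"
  have R: "measure P {\<omega> \<in> space P. \<omega> 0 \<noteq> best_predictor tie P ?Y \<omega>} = ?R"
  proof -
    interpret P: prob_space P
      using assms(4) by (simp add: stationary_distribution_def P_def)
    have Y: "random_process P ?Y"
      using P.prob_space_axioms sets_P by (rule random_process_coordinates)
    interpret P: finite_measure_subalgebra P "past_algebra P ?Y"
      by unfold_locales (rule subalgebra_past_algebra[OF Y])
    have [measurable]: "best_predictor tie P ?Y \<in> P \<rightarrow>\<^sub>M count_space UNIV"
      unfolding best_predictor_def by (rule measurable_arg_max_by) (simp add: past_cond_prob_def)
    have [measurable]: "best_predictor tie M X \<in> M \<rightarrow>\<^sub>M count_space UNIV"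
      unfolding best_predictor_def by (rule measurable_arg_max_by) (simp add: past_cond_prob_def)
    have "measure P {\<omega> \<in> space P. \<omega> 0 \<noteq> best_predictor tie P ?Y \<omega>} =
        prob (?path -` {\<omega> \<in> space P. \<omega> 0 \<noteq> best_predictor tie P ?Y \<omega>} \<inter> space M)"
      by (subst P_distr, rule measure_distr) measurable
    also have "\<dots> = ?R"
    proof (rule finite_measure_eq_AE)
      have "AE \<omega> in M. \<forall>x. past_cond_prob M X x \<omega> = past_cond_prob P ?Y x (?path \<omega>)"
        unfolding AE_all_countable P_def
        using past_cond_prob_process_distribution[OF assms(3)] by blast
      then show "AE \<omega> in M. (\<omega> \<in> ?path -` {\<omega> \<in> space P. \<omega> 0 \<noteq> best_predictor tie P ?Y \<omega>} \<inter> space M) =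
          (\<omega> \<in> {\<omega> \<in> space M. X 0 \<omega> \<noteq> best_predictor tie M X \<omega>})"
        by eventually_elim (auto simp: best_predictor_def space_P)
    qed measurable
    finally show ?thesis .
  qed
  let ?avg = "\<lambda>n \<omega>. (\<Sum>t<n. of_bool (\<omega> (int t) \<noteq> online_predictor tie Q ?Y t \<omega>)) / real n"
  have avg_path: "(\<Sum>t<n. of_bool (X (int t) \<omega> \<noteq> online_predictor tie Q X t \<omega>)) / real n = ?avg n (?path \<omega>)" for n \<omega>
    by (simp add: online_path)
  have avg_meas [measurable]: "?avg n \<in> borel_measurable P" for n by measurable
  have avg_int: "integrable M (\<lambda>\<omega>. ?avg n (?path \<omega>))" for n
    by (intro integrable_divide Bochner_Integration.integrable_sum integrable_const_bound[where B=1])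
      auto
  have "(\<integral>\<omega>. \<bar>?avg n (?path \<omega>) - ?R\<bar> \<partial>M) = (\<integral>\<omega>. \<bar>?avg n \<omega> - ?R\<bar> \<partial>P)" for n
    by (subst P_distr, rule integral_distr[symmetric]) measurable
  then show ?thesis
    using prediction_error_rate_path_space[OF assms(1,2,4,5)] avg_int
    unfolding L1_convergent_to_def avg_path P_def[symmetric] R by simp
qed

end
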